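(* Let $G$ be a non-Abelian group. 1. If $\mathrm{cdim}(G)=2$ and $Z(G)=1$ then $G$ is a CT-group. Conversely, if $G$ is a CT-group then $\mathrm{cdim}(G)=2$ and $Z(G)=1$. 2. Suppose that every nilpotent subgroup of $G$ is Abelian. Then $\mathrm{cdim}(G)=2$ if and only if the factor group $G/Z(G)$ is a CT-group.
   Context: For a subset $S$ of a group $G$, $C_G(S)=\{g\in G: gs=sg \text{ for all } s\in S\}$ is the centraliser of $S$ in $G$; a centraliser in $G$ is a subgroup of this form. A centraliser chain of length $k$ in $G$ is a sequence $C_0>C_1>\cdots>C_k$ of centralisers in $G$ with all inclusions strict. If there is an integer $d$ such that $G$ has a centraliser chain of length $d$ and none of length greater than $d$, then the centraliser dimension of $G$ is $\mathrm{cdim}(G)=d$; if no such $d$ exists, $\mathrm{cdim}(G)=\infty$. $Z(G)$ denotes the centre of $G$. A group $G$ is a CT-group (commutative transitive) if for all $x,y,z\in G$: if $x\neq 1$ and $x$ commutes with both $y$ and $z$, then $y$ and $z$ commute. *)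

theory Defs
  imports "HOL-Algebra.Generated_Groups" "HOL-Library.Extended_Nat"
begin

definition centraliser :: "('a, 'b) monoid_scheme \<Rightarrow> 'a set \<Rightarrow> 'a set" where
  "centraliser G S = {g \<in> carrier G. \<forall>s\<in>S. g \<otimes>\<^bsub>G\<^esub> s = s \<otimes>\<^bsub>G\<^esub> g}"

definition centre :: "('a, 'b) monoid_scheme \<Rightarrow> 'a set" where
  "centre G = centraliser G (carrier G)"

definition is_centraliser :: "('a, 'b) monoid_scheme \<Rightarrow> 'a set \<Rightarrow> bool" where
  "is_centraliser G C \<longleftrightarrow> (\<exists>S \<subseteq> carrier G. C = centraliser G S)"

(* A chain of length k has the k + 1 terms C 0, ..., C k; later values of C are irrelevant. *)
definition centraliser_chain :: "('a, 'b) monoid_scheme \<Rightarrow> nat \<Rightarrow> (nat \<Rightarrow> 'a set) \<Rightarrow> bool" where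
  "centraliser_chain G k C \<longleftrightarrow>
     (\<forall>i\<le>k. is_centraliser G (C i)) \<and> (\<forall>i<k. C (Suc i) \<subset> C i)"

definition max_chain_length :: "('a, 'b) monoid_scheme \<Rightarrow> nat \<Rightarrow> bool" where
  "max_chain_length G d \<longleftrightarrow>
     (\<exists>C. centraliser_chain G d C) \<and> (\<forall>k>d. \<nexists>C. centraliser_chain G k C)"

definition cdim :: "('a, 'b) monoid_scheme \<Rightarrow> enat" where
  "cdim G = (if \<exists>d. max_chain_length G d then enat (THE d. max_chain_length G d) else \<infinity>)"

definition CT_group :: "('a, 'b) monoid_scheme \<Rightarrow> bool" where
  "CT_group G \<longleftrightarrow> group G \<and>
     (\<forall>x\<in>carrier G. \<forall>y\<in>carrier G. \<forall>z\<in>carrier G.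
        x \<noteq> \<one>\<^bsub>G\<^esub> \<and> x \<otimes>\<^bsub>G\<^esub> y = y \<otimes>\<^bsub>G\<^esub> x \<and> x \<otimes>\<^bsub>G\<^esub> z = z \<otimes>\<^bsub>G\<^esub> x
        \<longrightarrow> y \<otimes>\<^bsub>G\<^esub> z = z \<otimes>\<^bsub>G\<^esub> y)"

(* Indexed from 0: the term of index n is usually written with subscript n + 1.
   The commutator convention is that of the library's derived_set. *)
primrec lower_central :: "('a, 'b) monoid_scheme \<Rightarrow> nat \<Rightarrow> 'a set" where
  "lower_central G 0 = carrier G"
| "lower_central G (Suc n) = generate G
     (\<Union>x \<in> lower_central G n. \<Union>y \<in> carrier G.
        {x \<otimes>\<^bsub>G\<^esub> y \<otimes>\<^bsub>G\<^esub> inv\<^bsub>G\<^esub> x \<otimes>\<^bsub>G\<^esub> inv\<^bsub>G\<^esub> y})"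

definition nilpotent_group :: "('a, 'b) monoid_scheme \<Rightarrow> bool" where
  "nilpotent_group G \<longleftrightarrow> group G \<and> (\<exists>n. lower_central G n = {\<one>\<^bsub>G\<^esub>})"

end

theory Submission
  imports Defs
begin

text \<open>For non-Abelian \<open>G\<close>, \<open>cdim G = 2\<close> holds iff all centralisers of noncentral elements are
  Abelian. If \<open>x\<close> is noncentral and commutes with the noncommuting \<open>y\<close> and \<open>z\<close>, then
  \<open>G > C(x) > C(x, y) > Z(G)\<close>. Conversely, if centralisers of noncentral elements are Abelian and
  \<open>C\<^sub>0 > C\<^sub>1 > C\<^sub>2 > C\<^sub>3\<close>, then \<open>C\<^sub>1\<close> is Abelian and \<open>C\<^sub>2\<close> contains a noncentral \<open>y\<close>, and
  \<open>C(y)\<close> contains both \<open>C\<^sub>1\<close> and any set whose centraliser is \<open>C\<^sub>2\<close>; as \<open>C(y)\<close> is Abelian, this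
  gives \<open>C\<^sub>1 \<le> C\<^sub>2\<close>. For the quotient statement, elements that commute modulo the centre lie in a
  subgroup of nilpotency class at most 2, hence commute.\<close>

context group
begin

section \<open>Centralisers and the centre\<close>

lemma subgroup_centraliser:
  assumes "S \<subseteq> carrier G"
  shows "subgroup (centraliser G S) G"
proof (rule subgroupI)
  show "centraliser G S \<subseteq> carrier G"
    by (auto simp: centraliser_def)
  have "\<one> \<in> centraliser G S"
    using assms by (auto simp: centraliser_def)
  then show "centraliser G S \<noteq> {}" by blast
next
  fix a assume a: "a \<in> centraliser G S"
  then have ac: "a \<in> carrier G" by (simp add: centraliser_def)
  have "inv a \<otimes> s = s \<otimes> inv a" if "s \<in> S" for s
  proof -
    have sc: "s \<in> carrier G" and "a \<otimes> s = s \<otimes> a"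
      using a that assms by (auto simp: centraliser_def)
    then have "inv a \<otimes> (a \<otimes> s) \<otimes> inv a = inv a \<otimes> (s \<otimes> a) \<otimes> inv a" by simp
    then show ?thesis
      using ac sc by (metis inv_closed m_assoc m_closed r_inv l_inv r_one l_one)
  qed
  then show "inv a \<in> centraliser G S" using ac by (simp add: centraliser_def)
next
  fix a b assume "a \<in> centraliser G S" and "b \<in> centraliser G S"
  then show "a \<otimes> b \<in> centraliser G S"
    using assms by (auto simp: centraliser_def subset_eq) (metis m_assoc)
qed

lemma centre_subset_centraliser: "S \<subseteq> carrier G \<Longrightarrow> centre G \<subseteq> centraliser G S"
  by (auto simp: centre_def centraliser_def)

lemma centraliser_psubset_carrier:
  assumes "x \<in> carrier G" "x \<notin> centre G"
  shows "centraliser G {x} \<subset> carrier G"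
proof -
  obtain y where "y \<in> carrier G" "x \<otimes> y \<noteq> y \<otimes> x"
    using assms by (auto simp: centre_def centraliser_def)
  then have "y \<notin> centraliser G {x}" by (auto simp: centraliser_def)
  then show ?thesis using \<open>y \<in> carrier G\<close> by (auto simp: centraliser_def)
qed

lemma is_centraliser_simps:
  "S \<subseteq> carrier G \<Longrightarrow> is_centraliser G (centraliser G S)"
  "is_centraliser G (carrier G)"
  "is_centraliser G (centre G)"
proof -
  have "carrier G = centraliser G {}" by (simp add: centraliser_def)
  then show "is_centraliser G (carrier G)" unfolding is_centraliser_def by blast
qed (auto simp: is_centraliser_def centre_def)

lemma centre_normal: "centre G \<lhd> G"
proof -
  have "subgroup (centre G) G"
    unfolding centre_def by (rule subgroup_centraliser) simp
  moreover have "x \<otimes> h \<otimes> inv x \<in> centre G" if "x \<in> carrier G" "h \<in> centre G" for x h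
  proof -
    have "h \<in> carrier G" and "x \<otimes> h = h \<otimes> x"
      using that by (auto simp: centre_def centraliser_def)
    then have "x \<otimes> h \<otimes> inv x = h" using that(1) by (simp add: m_assoc)
    then show ?thesis using that(2) by simp
  qed
  ultimately show ?thesis by (simp add: normal_inv_iff)
qed

lemma exists_not_central:
  assumes "\<not> comm_group G"
  shows "\<exists>x\<in>carrier G. x \<notin> centre G"
  using assms group_comm_groupI by (auto simp: centre_def centraliser_def)

text \<open>Elementwise form of "the centraliser of every noncentral element is Abelian", matching
  the shape of \<open>CT_group\<close> with "noncentral" in place of "nontrivial".\<close>

definition commutative_centralisers :: bool where
  "commutative_centralisers \<longleftrightarrow>
     (\<forall>x\<in>carrier G - centre G. \<forall>y\<in>carrier G. \<forall>z\<in>carrier G.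
        x \<otimes> y = y \<otimes> x \<and> x \<otimes> z = z \<otimes> x \<longrightarrow> y \<otimes> z = z \<otimes> y)"

section \<open>Centraliser chains and the centraliser dimension\<close>

lemma centraliser_chain_2:
  assumes "\<not> comm_group G"
  shows "\<exists>C. centraliser_chain G 2 C"
proof -
  obtain x where x: "x \<in> carrier G" "x \<notin> centre G"
    using exists_not_central[OF assms] by blast
  define C where "C i = (if i = 0 then carrier G else if i = 1 then centraliser G {x} else centre G)"
    for i :: nat
  have "is_centraliser G (C i)" for i
    using x by (simp add: C_def is_centraliser_simps)
  moreover have "centraliser G {x} \<subset> carrier G"
    using x by (rule centraliser_psubset_carrier)
  \<comment> \<open>Strict because \<open>x\<close> lies in its own centraliser but is not
    central.\<close>
  moreover have "centre G \<subset> centraliser G {x}"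
    using x centre_subset_centraliser[of "{x}"] by (auto simp: centraliser_def)
  ultimately have "centraliser_chain G 2 C"
    by (auto simp: centraliser_chain_def C_def numeral_2_eq_2 less_Suc_eq)
  then show ?thesis by blast
qed

lemma centraliser_chain_3:
  assumes "\<not> commutative_centralisers"
  shows "\<exists>C. centraliser_chain G 3 C"
proof -
  obtain x y z where xyz: "x \<in> carrier G" "y \<in> carrier G" "z \<in> carrier G" "x \<notin> centre G"
    "x \<otimes> y = y \<otimes> x" "x \<otimes> z = z \<otimes> x" "y \<otimes> z \<noteq> z \<otimes> y"
    using assms by (auto simp: commutative_centralisers_def)
  define C where "C i = (if i = 0 then carrier G else if i = 1 then centraliser G {x}
    else if i = 2 then centraliser G {x, y} else centre G)" for i :: nat
  have "is_centraliser G (C i)" for i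
    using xyz by (simp add: C_def is_centraliser_simps)
  moreover have "centraliser G {x} \<subset> carrier G"
    using xyz by (intro centraliser_psubset_carrier)
  moreover have "centraliser G {x, y} \<subset> centraliser G {x}"
  proof -
    have "z \<in> centraliser G {x}" "z \<notin> centraliser G {x, y}"
      using xyz by (auto simp: centraliser_def)
    then show ?thesis by (auto simp: centraliser_def)
  qed
  moreover have "centre G \<subset> centraliser G {x, y}"
  proof -
    \<comment> \<open>As \<open>x\<close> commutes with \<open>y\<close>, it is the noncentral
      element that makes the last inclusion strict.\<close>
    have "x \<in> centraliser G {x, y}" using xyz by (auto simp: centraliser_def)
    then show ?thesis using xyz centre_subset_centraliser[of "{x, y}"] by auto
  qed
  ultimately have "centraliser_chain G 3 C"
    by (auto simp: centraliser_chain_def C_def numeral_3_eq_3 less_Suc_eq)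
  then show ?thesis by blast
qed

lemma centraliser_chain_le_2:
  assumes comm: "commutative_centralisers" and chain: "centraliser_chain G k C"
  shows "k \<le> 2"
proof (rule ccontr)
  assume "\<not> k \<le> 2"
  then have cent: "is_centraliser G (C 0)" "is_centraliser G (C 1)" "is_centraliser G (C 2)"
      "is_centraliser G (C 3)"
    and less: "C 1 \<subset> C 0" "C 2 \<subset> C 1" "C 3 \<subset> C 2"
    using chain by (auto simp: centraliser_chain_def numeral_2_eq_2 numeral_3_eq_3)
  obtain S T where S: "S \<subseteq> carrier G" "C 1 = centraliser G S"
    and T: "T \<subseteq> carrier G" "C 2 = centraliser G T"
    using cent unfolding is_centraliser_def by blast
  \<comment> \<open>\<open>C 0\<close> forces \<open>C 1\<close> to be proper; hence some
    \<open>s\<close> in \<open>S\<close> is noncentral and \<open>C 1\<close> lies in the Abelian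
    centraliser of \<open>s\<close>.\<close>
  have "C 1 \<noteq> carrier G"
    using less(1) cent(1) by (auto simp: is_centraliser_def centraliser_def)
  have "\<not> S \<subseteq> centre G"
  proof
    assume "S \<subseteq> centre G"
    then have "carrier G \<subseteq> C 1" using S by (fastforce simp: centraliser_def centre_def)
    then show False using \<open>C 1 \<noteq> carrier G\<close> S by (auto simp: centraliser_def)
  qed
  then obtain s where s: "s \<in> S" "s \<notin> centre G" by blast
  have "centre G \<subseteq> C 3"
    using cent(4) centre_subset_centraliser by (auto simp: is_centraliser_def)
  \<comment> \<open>\<open>C 3\<close> contains the centre, so anything in \<open>C 2\<close>
    outside \<open>C 3\<close> is noncentral.\<close>
  then obtain y where y: "y \<in> C 2" "y \<notin> centre G" using less(3) by blast
  obtain w where w: "w \<in> C 1" "w \<notin> C 2" using less(2) by blast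
  have wc: "w \<in> carrier G" and yc: "y \<in> carrier G" and sc: "s \<in> carrier G"
    using w y S T s by (auto simp: centraliser_def)
  then obtain t where t: "t \<in> T" "w \<otimes> t \<noteq> t \<otimes> w"
    using w T by (auto simp: centraliser_def)
  have "w \<otimes> s = s \<otimes> w" "y \<otimes> s = s \<otimes> y"
    using w y less(2) S s by (auto simp: centraliser_def)
  \<comment> \<open>Both \<open>y\<close> and \<open>w\<close> centralise the noncentral
    \<open>s\<close>.\<close>
  then have "y \<otimes> w = w \<otimes> y"
    using comm sc s wc yc unfolding commutative_centralisers_def by (metis DiffI)
  moreover have "y \<otimes> t = t \<otimes> y"
    using y t T by (auto simp: centraliser_def)
  moreover have "t \<in> carrier G" using t T by blast
  \<comment> \<open>Both \<open>w\<close> and \<open>t\<close> centralise the noncentral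
    \<open>y\<close>, so they commute, against the choice of \<open>t\<close>.\<close>
  ultimately show False
    using comm yc y wc t unfolding commutative_centralisers_def by (metis DiffI)
qed

text \<open>A maximal chain length is unique, so the description operator in \<open>cdim\<close>
  returns it.\<close>

lemma cdim_eq_enat_iff: "cdim G = enat d \<longleftrightarrow> max_chain_length G d"
proof -
  have unique: "d = e" if "max_chain_length G d" "max_chain_length G e" for d e
    using that unfolding max_chain_length_def by (metis linorder_neqE_nat)
  have "(THE d. max_chain_length G d) = d" if "max_chain_length G d" for d
    using that unique by blast
  then show ?thesis by (auto simp: cdim_def)
qed

lemma cdim_eq_2_iff:
  assumes "\<not> comm_group G"
  shows "cdim G = 2 \<longleftrightarrow> commutative_centralisers"
proof -
  have "cdim G = 2 \<longleftrightarrow> max_chain_length G 2"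
    using cdim_eq_enat_iff[of 2] by (simp add: numeral_eq_enat)
  also have "\<dots> \<longleftrightarrow> commutative_centralisers"
  proof
    assume "max_chain_length G 2"
    then have "\<nexists>C. centraliser_chain G 3 C" by (simp add: max_chain_length_def)
    then show "commutative_centralisers" using centraliser_chain_3 by blast
  next
    assume "commutative_centralisers"
    then show "max_chain_length G 2"
      using centraliser_chain_2[OF assms] centraliser_chain_le_2
      unfolding max_chain_length_def by (meson linorder_not_less)
  qed
  finally show ?thesis .
qed

text \<open>A nontrivial central element of a CT-group would make any two elements commute. Once the
  centre is trivial, "noncentral" and "nontrivial" coincide.\<close>

lemma CT_group_iff:
  assumes "\<not> comm_group G"
  shows "CT_group G \<longleftrightarrow> commutative_centralisers \<and> centre G = {\<one>}"
proof
  assume CT: "CT_group G"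
  have "x = \<one>" if x: "x \<in> centre G" for x
  proof (rule ccontr)
    assume "x \<noteq> \<one>"
    moreover have "x \<in> carrier G" "\<forall>y\<in>carrier G. x \<otimes> y = y \<otimes> x"
      using x by (auto simp: centre_def centraliser_def)
    ultimately have "\<forall>y\<in>carrier G. \<forall>z\<in>carrier G. y \<otimes> z = z \<otimes> y"
      using CT unfolding CT_group_def by blast
    then show False using assms group_comm_groupI by blast
  qed
  moreover have "\<one> \<in> centre G" by (simp add: centre_def centraliser_def)
  ultimately have Z: "centre G = {\<one>}" by blast
  then show "commutative_centralisers \<and> centre G = {\<one>}"
    using CT unfolding CT_group_def commutative_centralisers_def by blast
next
  assume "commutative_centralisers \<and> centre G = {\<one>}"
  then show "CT_group G"
    using is_group unfolding CT_group_def commutative_centralisers_def by blast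
qed

section \<open>Nilpotency and the quotient by the centre\<close>

lemma nilpotent_groupI_commutators_central:
  assumes "\<And>x y. x \<in> carrier G \<Longrightarrow> y \<in> carrier G \<Longrightarrow> x \<otimes> y \<otimes> inv x \<otimes> inv y \<in> centre G"
  shows "nilpotent_group G"
proof -
  have "lower_central G 1 = generate G (\<Union>x\<in>carrier G. \<Union>y\<in>carrier G.
      {x \<otimes> y \<otimes> inv x \<otimes> inv y})"
    by simp
  also have "\<dots> \<subseteq> centre G"
    by (rule generate_subgroup_incl[OF _ normal_imp_subgroup[OF centre_normal]])
      (use assms in blast)
  finally have *: "lower_central G 1 \<subseteq> centre G" .
  \<comment> \<open>With indexing from 0, \<open>lower_central G 1\<close> is the derived subgroup;
    being central, it makes the term of index 2 trivial.\<close>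
  have "x \<otimes> y \<otimes> inv x \<otimes> inv y = \<one>" if "x \<in> lower_central G 1" "y \<in> carrier G" for x y
  proof -
    have "x \<in> carrier G" "x \<otimes> y = y \<otimes> x"
      using that * unfolding centre_def centraliser_def by blast+
    then show ?thesis using that(2) by (simp add: m_assoc)
  qed
  then have "(\<Union>x\<in>lower_central G 1. \<Union>y\<in>carrier G. {x \<otimes> y \<otimes> inv x \<otimes> inv y}) \<subseteq> {\<one>}"
    by blast
  then have "lower_central G (Suc 1) \<subseteq> {\<one>}"
    unfolding lower_central.simps(2)[of G 1] by (rule generate_subgroup_incl[OF _ triv_subgroup])
  then have "lower_central G 2 \<subseteq> {\<one>}" by (simp add: numeral_2_eq_2 del: lower_central.simps)
  moreover have "\<one> \<in> lower_central G 2" by (simp add: numeral_2_eq_2 generate.one)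
  ultimately show ?thesis using is_group unfolding nilpotent_group_def by blast
qed

text \<open>The commutator is the quotient of \<open>x \<otimes> y\<close> by
  \<open>y \<otimes> x\<close>, so it lies in \<open>N\<close> exactly when these products have the
  same coset.\<close>

lemma cosets_commute_iff:
  assumes "N \<lhd> G" "x \<in> carrier G" "y \<in> carrier G"
  shows "(N #> x) <#> (N #> y) = (N #> y) <#> (N #> x) \<longleftrightarrow> x \<otimes> y \<otimes> inv x \<otimes> inv y \<in> N"
proof -
  interpret N: normal N G by fact
  have "(N #> x) <#> (N #> y) = (N #> y) <#> (N #> x) \<longleftrightarrow> N #> (x \<otimes> y) = N #> (y \<otimes> x)"
    using assms by (simp add: N.rcos_sum)
  also have "\<dots> \<longleftrightarrow> x \<otimes> y \<in> N #> (y \<otimes> x)"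
    using assms by (metis m_closed rcos_self repr_independence N.subgroup_axioms)
  also have "\<dots> \<longleftrightarrow> x \<otimes> y \<otimes> inv (y \<otimes> x) \<in> N"
    using assms by (simp add: N.rcos_module[OF is_group])
  finally show ?thesis using assms by (simp add: inv_mult_group m_assoc)
qed

text \<open>The double centraliser of two commuting elements is commutative and contains both; for the
  images of \<open>x\<close> and \<open>y\<close> in the quotient, its preimage in \<open>G\<close> replaces the subgroup
  generated by \<open>x\<close> and \<open>y\<close>.\<close>

lemma commute_if_commute_mod_centre:
  assumes nilp: "\<And>H. subgroup H G \<Longrightarrow> nilpotent_group (G\<lparr>carrier := H\<rparr>) \<Longrightarrow>
      comm_group (G\<lparr>carrier := H\<rparr>)"
    and x: "x \<in> carrier G" and y: "y \<in> carrier G"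
    and xy: "x \<otimes> y \<otimes> inv x \<otimes> inv y \<in> centre G"
  shows "x \<otimes> y = y \<otimes> x"
proof -
  let ?Z = "centre G"
  let ?Q = "G Mod ?Z"
  let ?q = "\<lambda>g. ?Z #> g"
  interpret Z: normal ?Z G by (rule centre_normal)
  interpret Q: group ?Q by (rule Z.factorgroup_is_group)
  interpret q: group_hom G ?Q ?q
    using Z.r_coset_hom_Mod by unfold_locales auto
  define T where "T = {?q x, ?q y}"
  define D where "D = centraliser ?Q (centraliser ?Q T)"
  have T: "T \<subseteq> carrier ?Q" using x y by (auto simp: T_def)
  have comm: "?q x \<otimes>\<^bsub>?Q\<^esub> ?q y = ?q y \<otimes>\<^bsub>?Q\<^esub> ?q x"
    using cosets_commute_iff[OF centre_normal x y] xy by (simp add: FactGroup_def)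
  have TT: "T \<subseteq> centraliser ?Q T"
    using comm T by (auto simp: centraliser_def T_def)
  have TD: "T \<subseteq> D" using T by (auto simp: centraliser_def D_def)
  have Dcomm: "a \<otimes>\<^bsub>?Q\<^esub> b = b \<otimes>\<^bsub>?Q\<^esub> a" if "a \<in> D" "b \<in> D" for a b
  proof -
    \<comment> \<open>Since \<open>T\<close> lies in its own centraliser, \<open>D\<close> lies in
      the centraliser of \<open>T\<close>, all of which commutes with \<open>a\<close>.\<close>
    have "b \<in> centraliser ?Q T" using that TT by (auto simp: centraliser_def D_def)
    then show ?thesis using that by (auto simp: centraliser_def D_def)
  qed
  have "subgroup D ?Q"
    unfolding D_def by (rule Q.subgroup_centraliser) (auto simp: centraliser_def)
  define H where "H = {h \<in> carrier G. ?q h \<in> D}"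
  have H: "subgroup H G"
  proof (rule subgroupI)
    show "H \<subseteq> carrier G" by (auto simp: H_def)
    show "H \<noteq> {}" using x TD by (auto simp: H_def T_def)
    show "inv a \<in> H" if "a \<in> H" for a
      using that q.hom_inv[of a] subgroup.m_inv_closed[OF \<open>subgroup D ?Q\<close>, of "?q a"]
      by (simp add: H_def)
    show "a \<otimes> b \<in> H" if "a \<in> H" "b \<in> H" for a b
      using that q.hom_mult[of a b] subgroup.m_closed[OF \<open>subgroup D ?Q\<close>, of "?q a" "?q b"]
      by (simp add: H_def)
  qed
  interpret H: group "G\<lparr>carrier := H\<rparr>" by (rule subgroup_imp_group[OF H])
  have "nilpotent_group (G\<lparr>carrier := H\<rparr>)"
  proof (rule H.nilpotent_groupI_commutators_central)
    fix a b assume "a \<in> carrier (G\<lparr>carrier := H\<rparr>)" "b \<in> carrier (G\<lparr>carrier := H\<rparr>)"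
    then have ab: "a \<in> H" "b \<in> H" by auto
    then have abc: "a \<in> carrier G" "b \<in> carrier G" by (auto simp: H_def)
    \<comment> \<open>The images of \<open>a\<close> and \<open>b\<close> lie in the commutative
      \<open>D\<close>, so their commutator is central in \<open>G\<close>, and therefore in
      \<open>H\<close>.\<close>
    have "a \<otimes> b \<otimes> inv a \<otimes> inv b \<in> centre G"
      using Dcomm[of "?q a" "?q b"] cosets_commute_iff[OF centre_normal abc] ab
      by (auto simp: H_def FactGroup_def)
    moreover have "a \<otimes> b \<otimes> inv a \<otimes> inv b \<in> H"
      using ab H by (simp add: subgroup.m_closed subgroup.m_inv_closed)
    moreover have "H \<subseteq> carrier G" by (auto simp: H_def)
    ultimately have "a \<otimes> b \<otimes> inv a \<otimes> inv b \<in> centre (G\<lparr>carrier := H\<rparr>)"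
      unfolding centre_def centraliser_def by auto
    then show "a \<otimes>\<^bsub>G\<lparr>carrier := H\<rparr>\<^esub> b \<otimes>\<^bsub>G\<lparr>carrier := H\<rparr>\<^esub> inv\<^bsub>G\<lparr>carrier := H\<rparr>\<^esub> a
        \<otimes>\<^bsub>G\<lparr>carrier := H\<rparr>\<^esub> inv\<^bsub>G\<lparr>carrier := H\<rparr>\<^esub> b \<in> centre (G\<lparr>carrier := H\<rparr>)"
      using m_inv_consistent[OF H] ab by simp
  qed
  then interpret H: comm_group "G\<lparr>carrier := H\<rparr>" using nilp H by blast
  have "x \<in> H" "y \<in> H" using x y TD by (auto simp: H_def T_def)
  then show ?thesis using H.m_comm by simp
qed

text \<open>Under the hypothesis on nilpotent subgroups, cosets of the centre commute iff their
  representatives do, and a coset is trivial iff its representative is central. Commutative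
  transitivity of the quotient thus translates into a condition on representatives.\<close>

lemma CT_group_Mod_centre_iff:
  assumes nilp: "\<And>H. subgroup H G \<Longrightarrow> nilpotent_group (G\<lparr>carrier := H\<rparr>) \<Longrightarrow>
      comm_group (G\<lparr>carrier := H\<rparr>)"
  shows "CT_group (G Mod centre G) \<longleftrightarrow> commutative_centralisers"
proof -
  let ?Z = "centre G"
  interpret Z: normal ?Z G by (rule centre_normal)
  have one: "x \<in> ?Z \<longleftrightarrow> ?Z #> x = ?Z" if "x \<in> carrier G" for x
    using that Z.subgroup_axioms coset_join1 coset_join2 by blast
  have comm: "(?Z #> x) <#> (?Z #> y) = (?Z #> y) <#> (?Z #> x) \<longleftrightarrow> x \<otimes> y = y \<otimes> x"
    if "x \<in> carrier G" "y \<in> carrier G" for x y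
    using that cosets_commute_iff[OF centre_normal that] commute_if_commute_mod_centre[OF nilp that]
    by (metis Z.rcos_sum)
  have "CT_group (G Mod ?Z) \<longleftrightarrow>
      (\<forall>x\<in>carrier G. \<forall>y\<in>carrier G. \<forall>z\<in>carrier G.
        x \<notin> ?Z \<and> x \<otimes> y = y \<otimes> x \<and> x \<otimes> z = z \<otimes> x \<longrightarrow> y \<otimes> z = z \<otimes> y)"
    by (simp add: CT_group_def Z.factorgroup_is_group carrier_FactGroup one comm cong: ball_cong)
  then show ?thesis unfolding commutative_centralisers_def by blast
qed

end

theorem proposition3p9:
  fixes G :: "('a, 'b) monoid_scheme"
  assumes "group G" and "\<not> comm_group G"
  shows "(cdim G = 2 \<and> centre G = {\<one>\<^bsub>G\<^esub>} \<longrightarrow> CT_group G) \<and>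
         (CT_group G \<longrightarrow> cdim G = 2 \<and> centre G = {\<one>\<^bsub>G\<^esub>}) \<and>
         ((\<forall>H. subgroup H G \<and> nilpotent_group (G\<lparr>carrier := H\<rparr>)
                \<longrightarrow> comm_group (G\<lparr>carrier := H\<rparr>)) \<longrightarrow>
          (cdim G = 2 \<longleftrightarrow> CT_group (G Mod centre G)))"
proof -
  interpret group G by fact
  show ?thesis
    using cdim_eq_2_iff CT_group_iff CT_group_Mod_centre_iff assms(2) by blast
qed

end
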